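(* Fix an integer $d\ge 2$ and real constants $a_1,\ldots,a_d>0$, and let $\lambda_c$ be the unique positive solution to $\det(\boldsymbol{M}_{\lambda_c}-\boldsymbol{I})=0$. If $0\le\lambda<\lambda_c$ and $p=\frac{\lambda}{n}$, then the largest connected component of the random site subgraph of the Hamming torus has $O(\log n)$ vertices asymptotically almost surely; that is, there is a constant $C$ (not depending on $n$) such that the probability that every connected component has at most $C\log n$ vertices tends to $1$ as $n\to\infty$.
   Context: The $d$-dimensional Hamming torus (with parameters $a_1,\ldots,a_d>0$ and $n$) is the graph with vertex set $V=\{(x_1,\ldots,x_d)\in\mathbb{Z}^d: 1\le x_i\le a_i n,\ i=1,\ldots,d\}$ in which two vertices are adjacent exactly when they differ in exactly one coordinate (Hamming distance one). The random site subgraph with parameter $p$ is the induced subgraph obtained by independently keeping each vertex (calling it occupied) with probability $p$ and removing it, together with all incident edges, with probability $1-p$. $\boldsymbol{M}_\lambda$ is the $d\times d$ matrix whose diagonal entries are $0$ and whose $(i,j)$ entry for $i\ne j$ is $\lambda a_j$; $\boldsymbol{I}$ is the $d\times d$ identity matrix. "Asymptotically almost surely" (a.a.s.) means with probability tending to $1$ as $n\to\infty$, with $d,a_1,\ldots,a_d,\lambda$ fixed. *)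

theory Defs
  imports "Graph_Theory.Digraph_Component" "HOL-Probability.Probability"
begin

definition hamming_dist :: "'a ^ 'd \<Rightarrow> 'a ^ 'd \<Rightarrow> nat" where
  "hamming_dist x y = card {i. x $ i \<noteq> y $ i}"

definition torus_vertices :: "real ^ 'd \<Rightarrow> nat \<Rightarrow> (int ^ 'd) set" where
  "torus_vertices a n = {x. \<forall>i. 1 \<le> x $ i \<and> real_of_int (x $ i) \<le> a $ i * real n}"

text \<open>An undirected graph is represented, as usual in Graph_Theory, by a symmetric
  digraph with one arc in each direction for every edge; see \<open>pair_graph_hamming_torus\<close>.\<close>

definition hamming_torus :: "real ^ 'd \<Rightarrow> nat \<Rightarrow> (int ^ 'd) pair_pre_digraph" where
  "hamming_torus a n =
     \<lparr>pverts = torus_vertices a n,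
      parcs = {(x, y). x \<in> torus_vertices a n \<and> y \<in> torus_vertices a n \<and> hamming_dist x y = 1}\<rparr>"

text \<open>Note that \<^const>\<open>bernoulli_pmf\<close> clamps its parameter to the unit interval. For
  \<open>p = \<lambda> / n\<close> this only affects the finitely many \<open>n\<close> with \<open>n < \<lambda>\<close>.\<close>

definition random_site_subgraph ::
  "real ^ 'd \<Rightarrow> nat \<Rightarrow> real \<Rightarrow> (int ^ 'd, (int ^ 'd) \<times> (int ^ 'd)) pre_digraph pmf" where
  "random_site_subgraph a n p =
     map_pmf (\<lambda>\<omega>. with_proj (hamming_torus a n) \<restriction> {x \<in> torus_vertices a n. \<omega> x})
       (Pi_pmf (torus_vertices a n) False (\<lambda>_. bernoulli_pmf p))"

text \<open>In a symmetric digraph reachability is symmetric, so the strongly connected components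
  are the connected components of the underlying undirected graph.\<close>

definition component_vertex_sets :: "('v, 'e) pre_digraph \<Rightarrow> 'v set set" where
  "component_vertex_sets G = pre_digraph.sccs_verts G"

definition M_matrix :: "real ^ 'd \<Rightarrow> real \<Rightarrow> real ^ 'd ^ 'd" where
  "M_matrix a l = (\<chi> i j. if i = j then 0 else l * a $ j)"

definition lambda_c :: "real ^ 'd \<Rightarrow> real" where
  "lambda_c a = (THE l. l > 0 \<and> det (M_matrix a l - mat 1) = 0)"

lemma finite_torus_vertices:
  fixes a :: "real ^ 'd"
  shows "finite (torus_vertices a n)"
proof -
  define N where "N = (\<Sum>i\<in>UNIV. \<lceil>\<bar>a $ i\<bar> * real n\<rceil>)"
  have "torus_vertices a n \<subseteq> vec_lambda ` (UNIV \<rightarrow>\<^sub>E {1..N})"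
  proof
    fix x assume x: "x \<in> torus_vertices a n"
    have "x $ i \<in> {1..N}" for i
    proof -
      have "real_of_int (x $ i) \<le> a $ i * real n" and "1 \<le> x $ i"
        using x by (auto simp: torus_vertices_def)
      moreover have "a $ i * real n \<le> \<bar>a $ i\<bar> * real n"
        by (intro mult_right_mono) auto
      ultimately have "x $ i \<le> \<lceil>\<bar>a $ i\<bar> * real n\<rceil>"
        by linarith
      also have "\<dots> \<le> N"
        unfolding N_def
      proof (rule member_le_sum)
        fix j
        have "0 \<le> \<bar>a $ j\<bar> * real n" by simp
        then show "0 \<le> \<lceil>\<bar>a $ j\<bar> * real n\<rceil>" by linarith
      qed auto
      finally show ?thesis using \<open>1 \<le> x $ i\<close> by simp
    qed
    then have "(\<lambda>i. x $ i) \<in> UNIV \<rightarrow>\<^sub>E {1..N}"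
      by (auto simp: PiE_def)
    then show "x \<in> vec_lambda ` (UNIV \<rightarrow>\<^sub>E {1..N})"
      by (metis image_eqI vec_nth_inverse)
  qed
  moreover have "finite (UNIV \<rightarrow>\<^sub>E {1..N} :: ('d \<Rightarrow> int) set)"
    by (intro finite_PiE) auto
  ultimately show ?thesis
    by (meson finite_imageI finite_subset)
qed

lemma pair_graph_hamming_torus: "pair_graph (hamming_torus a n)"
proof
  show "finite (pverts (hamming_torus a n))"
    by (simp add: hamming_torus_def finite_torus_vertices)
  have "parcs (hamming_torus a n) \<subseteq> torus_vertices a n \<times> torus_vertices a n"
    by (auto simp: hamming_torus_def)
  then show "finite (parcs (hamming_torus a n))"
    by (meson finite_SigmaI finite_subset finite_torus_vertices)
  show "symmetric (with_proj (hamming_torus a n))"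
    unfolding symmetric_def with_proj_simps
    by (auto simp: sym_def hamming_torus_def hamming_dist_def eq_commute)
qed (auto simp: hamming_torus_def hamming_dist_def)

end

theory Submission
  imports Defs
begin

text \<open>Solving for a kernel vector, \<open>det (M\<^sub>\<lambda> - I) = 0\<close> holds iff
  \<open>\<Sum>i. \<lambda> a\<^sub>i / (1 + \<lambda> a\<^sub>i) = 1\<close>, and the left-hand side is strictly increasing in \<open>\<lambda>\<close>.
  Below \<open>\<lambda>\<^sub>c\<close> the sum is less than 1. Explore a component from a vertex by revealing sites one
  at a time, always on a line that passes through a vertex already found. Give an active line of direction \<open>k\<close> the
  weight \<open>exp s\<^sub>k\<close>; a newly found vertex of a line of direction \<open>k\<close> activates its lines in the
  other directions. Hence an exponential moment of the component size is bounded by the product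
  of the weights of the initial lines, uniformly in \<open>n\<close>, as soon as
  \<open>\<lambda> a\<^sub>k (exp (\<theta> + \<Sum>i\<noteq>k. s\<^sub>i) - 1) \<le> s\<^sub>k\<close> for all \<open>k\<close>, which subcriticality permits for small
  positive \<open>\<theta>\<close> and \<open>s\<close>. Markov's inequality and a union bound over the \<open>O(n\<^sup>d)\<close> starting
  vertices conclude.\<close>

section \<open>The critical value as the root of a scalar equation\<close>

definition branching_sum :: "real ^ 'd \<Rightarrow> real \<Rightarrow> real" where
  "branching_sum a l = (\<Sum>i\<in>UNIV. l * a $ i / (1 + l * a $ i))"

text \<open>\<open>M_matrix a l - mat 1\<close> is a rank-one matrix, all rows equal to
  \<open>l * a\<close>, minus the diagonal matrix with entries \<open>1 + l * a $ i\<close>. The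
  coordinates of \<open>v\<close> thus interact through one scalar only.\<close>

lemma M_matrix_mult_nth:
  "((M_matrix a l - mat 1) *v v) $ i = l * (\<Sum>j\<in>UNIV. a $ j * v $ j) - (1 + l * a $ i) * v $ i"
proof -
  have "((M_matrix a l - mat 1) *v v) $ i
      = (\<Sum>j\<in>UNIV. l * (a $ j * v $ j) - (if j = i then (1 + l * a $ i) * v $ i else 0))"
    unfolding matrix_vector_mult_def M_matrix_def mat_def vec_lambda_beta
    by (rule sum.cong) (auto simp: algebra_simps)
  also have "\<dots> = l * (\<Sum>j\<in>UNIV. a $ j * v $ j) - (1 + l * a $ i) * v $ i"
    by (simp add: sum_subtractf sum_distrib_left)
  finally show ?thesis .
qed

lemma det_M_matrix_eq_0_iff:
  fixes a :: "real ^ 'd"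
  assumes "l \<ge> 0" "\<And>i. a $ i > 0"
  shows "det (M_matrix a l - mat 1) = 0 \<longleftrightarrow> branching_sum a l = 1"
proof -
  let ?A = "M_matrix a l - mat 1"
  have pos: "1 + l * a $ i > 0" for i
    using assms(1) assms(2)[of i] by (simp add: add_pos_nonneg)
  have "det ?A = 0 \<longleftrightarrow> (\<exists>v. v \<noteq> 0 \<and> ?A *v v = 0)"
    using invertible_det_nz[of ?A] matrix_left_invertible_ker[of ?A] invertible_left_inverse[of ?A]
    by blast
  also have "\<dots> \<longleftrightarrow> branching_sum a l = 1"
  proof
    assume "\<exists>v. v \<noteq> 0 \<and> ?A *v v = 0"
    then obtain v where v: "v \<noteq> 0" "?A *v v = 0" by blast
    \<comment> \<open>In the kernel every coordinate is a multiple of \<open>S\<close>; feeding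
      these values back into \<open>S\<close> leaves one scalar equation.\<close>
    define S where "S = (\<Sum>j\<in>UNIV. a $ j * v $ j)"
    have vi: "v $ i = l * S / (1 + l * a $ i)" for i
      using M_matrix_mult_nth[of a l v i] v(2) pos[of i] by (simp add: S_def field_simps)
    have "S \<noteq> 0"
    proof
      assume "S = 0"
      then have "v = 0" using vi by (simp add: vec_eq_iff)
      with v(1) show False by simp
    qed
    have "S = (\<Sum>j\<in>UNIV. S * (l * a $ j / (1 + l * a $ j)))"
      by (subst S_def, rule sum.cong) (simp_all add: vi)
    then have "S = S * branching_sum a l"
      by (simp add: branching_sum_def sum_distrib_left)
    with \<open>S \<noteq> 0\<close> show "branching_sum a l = 1" by simp
  next
    assume f: "branching_sum a l = 1"
    \<comment> \<open>The kernel vector forced above, scaled so that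
      \<open>l * S = 1\<close>.\<close>
    define v :: "real ^ 'd" where "v = (\<chi> i. 1 / (1 + l * a $ i))"
    have "v \<noteq> 0" using pos by (auto simp: v_def vec_eq_iff less_le)
    moreover have "?A *v v = 0"
    proof -
      have "l * (\<Sum>j\<in>UNIV. a $ j * v $ j) = branching_sum a l"
        by (simp add: branching_sum_def sum_distrib_left v_def)
      moreover have "(1 + l * a $ i) * v $ i = 1" for i
        using pos[of i] by (simp add: v_def)
      ultimately show ?thesis
        by (simp add: vec_eq_iff M_matrix_mult_nth f)
    qed
    ultimately show "\<exists>v. v \<noteq> 0 \<and> ?A *v v = 0" by blast
  qed
  finally show ?thesis .
qed

lemma branching_sum_strict_mono:
  fixes a :: "real ^ 'd"
  assumes "0 \<le> l" "l < m" "\<And>i. a $ i > 0"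
  shows "branching_sum a l < branching_sum a m"
  unfolding branching_sum_def
proof (rule sum_strict_mono)
  fix i
  have *: "0 \<le> l * a $ i" "l * a $ i < m * a $ i"
    using assms(1,2) assms(3)[of i] by simp_all
  then show "l * a $ i / (1 + l * a $ i) < m * a $ i / (1 + m * a $ i)"
    by (simp add: divide_less_eq less_divide_eq) (simp add: field_simps)
qed auto

lemma ex1_branching_sum_eq_1:
  fixes a :: "real ^ 'd"
  assumes "CARD('d) \<ge> 2" and pos: "\<And>i. a $ i > 0"
  shows "\<exists>!l. l > 0 \<and> branching_sum a l = 1"
proof -
  \<comment> \<open>Every \<open>L * a $ i\<close> is at least 1, so every summand at
    \<open>L\<close> is at least 1/2.\<close>
  define L where "L = (\<Sum>i\<in>UNIV. 1 / a $ i)"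
  have L_ge: "1 \<le> L * a $ i" for i
  proof -
    have "1 / a $ i \<le> L" unfolding L_def
      by (rule member_le_sum) (use pos less_imp_le in auto)
    then show ?thesis using pos[of i] by (simp add: field_simps)
  qed
  have "L \<ge> 0" unfolding L_def by (intro sum_nonneg) (simp add: pos less_imp_le)
  \<comment> \<open>Two such summands suffice. In dimension one the sum stays below 1 and there is
    no positive root.\<close>
  have "1 \<le> (\<Sum>i\<in>(UNIV::'d set). 1/2 :: real)" using assms(1) by simp
  also have "\<dots> \<le> branching_sum a L" unfolding branching_sum_def
  proof (rule sum_mono)
    fix i show "1 / 2 \<le> L * a $ i / (1 + L * a $ i)"
      using L_ge[of i] by (simp add: field_simps)
  qed
  finally have "branching_sum a L \<ge> 1" .
  moreover have "branching_sum a 0 \<le> 1" by (simp add: branching_sum_def)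
  moreover have "continuous_on {0..L} (branching_sum a)"
    unfolding branching_sum_def
  proof (intro continuous_intros ballI)
    fix x i assume "x \<in> {0..L}"
    then have "0 \<le> x * a $ i" using pos[of i] by simp
    then show "1 + x * a $ i \<noteq> 0" by linarith
  qed
  ultimately obtain l where l: "0 \<le> l" "branching_sum a l = 1"
    using IVT'[of "branching_sum a" 0 1 L] \<open>L \<ge> 0\<close> by auto
  moreover have "l \<noteq> 0" using l by (auto simp: branching_sum_def)
  ultimately have "l > 0" by simp
  show ?thesis
  proof (intro ex1I[of _ l] conjI)
    fix m assume "m > 0 \<and> branching_sum a m = 1"
    then show "m = l"
      using branching_sum_strict_mono[of m l a] branching_sum_strict_mono[of l m a] l pos \<open>l > 0\<close>
      by (cases m l rule: linorder_cases) auto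
  qed (use l \<open>l > 0\<close> in auto)
qed

section \<open>Site-by-site exploration and its exponential moment\<close>

text \<open>Finite support makes every real function of the configuration integrable, as the
  monotonicity and Markov arguments require.\<close>

lemma finite_set_Pi_pmf_bool:
  fixes q :: "'v \<Rightarrow> bool pmf"
  assumes "finite A"
  shows "finite (set_pmf (Pi_pmf A dflt q))"
proof (rule finite_subset)
  show "set_pmf (Pi_pmf A dflt q) \<subseteq> PiE_dflt A dflt (\<lambda>_. UNIV)"
    using set_Pi_pmf_subset'[OF assms, of dflt q] by (auto simp: PiE_dflt_def)
qed (use assms in \<open>intro finite_PiE_dflt, auto\<close>)

lemma expectation_Pi_bernoulli_insert:
  fixes f :: "('v \<Rightarrow> bool) \<Rightarrow> real"
  assumes "finite A" "x \<notin> A" "0 \<le> p" "p \<le> 1"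
  shows "measure_pmf.expectation (Pi_pmf (insert x A) False (\<lambda>_. bernoulli_pmf p)) f
    = p * measure_pmf.expectation (Pi_pmf A False (\<lambda>_. bernoulli_pmf p)) (\<lambda>\<omega>. f (fun_upd \<omega> x True))
    + (1 - p) * measure_pmf.expectation (Pi_pmf A False (\<lambda>_. bernoulli_pmf p)) (\<lambda>\<omega>. f (fun_upd \<omega> x False))"
proof -
  let ?Q = "Pi_pmf A False (\<lambda>_. bernoulli_pmf p)"
  have "Pi_pmf (insert x A) False (\<lambda>_. bernoulli_pmf p)
      = bernoulli_pmf p \<bind> (\<lambda>y. map_pmf (\<lambda>\<omega>. fun_upd \<omega> x y) ?Q)"
    using assms(1,2) by (simp add: Pi_pmf_insert' map_pmf_def)
  then have "measure_pmf.expectation (Pi_pmf (insert x A) False (\<lambda>_. bernoulli_pmf p)) f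
    = (\<Sum>y\<in>UNIV. pmf (bernoulli_pmf p) y *\<^sub>R measure_pmf.expectation (map_pmf (\<lambda>\<omega>. fun_upd \<omega> x y) ?Q) f)"
    using finite_set_Pi_pmf_bool[OF assms(1)] by (subst pmf_expectation_bind[of UNIV, symmetric]) simp_all
  then show ?thesis
    using assms(3,4) by (simp add: UNIV_bool)
qed

text \<open>\<open>U\<close> holds the unrevealed sites and \<open>P\<close> the active lines. A line is coded by its direction
  together with \<open>line j y\<close>, which is common to exactly the sites of the line of direction \<open>j\<close>
  through \<open>y\<close>.\<close>

inductive_set cluster ::
  "('i \<Rightarrow> 'v \<Rightarrow> 'l) \<Rightarrow> 'v set \<Rightarrow> ('v \<Rightarrow> bool) \<Rightarrow> ('i \<times> 'l) set \<Rightarrow> 'v set"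
  for line U \<omega> P where
  start: "\<lbrakk>y \<in> U; \<omega> y; (j, line j y) \<in> P\<rbrakk> \<Longrightarrow> y \<in> cluster line U \<omega> P"
| step: "\<lbrakk>x \<in> cluster line U \<omega> P; y \<in> U; \<omega> y; line j y = line j x\<rbrakk> \<Longrightarrow> y \<in> cluster line U \<omega> P"

lemma cluster_subset: "cluster line U \<omega> P \<subseteq> U"
  by (auto elim: cluster.cases)

lemma cluster_empty:
  assumes "\<And>y j. y \<in> U \<Longrightarrow> (j, line j y) \<notin> P"
  shows "cluster line U \<omega> P = {}"
proof -
  have "False" if "x \<in> cluster line U \<omega> P" for x
    using that by induction (use assms in auto)
  then show ?thesis by blast
qed

text \<open>A vacant site is never found, so every derivation uses only sites of \<open>U\<close> on
  which both configurations agree.\<close>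

lemma cluster_reveal_False:
  "cluster line (insert y U) (fun_upd \<omega> y False) P \<subseteq> cluster line U \<omega> P"
proof
  fix x assume "x \<in> cluster line (insert y U) (fun_upd \<omega> y False) P"
  then show "x \<in> cluster line U \<omega> P"
    by induction (auto split: if_splits intro: cluster.intros)
qed

text \<open>Whatever is reached directly from \<open>y\<close> lies on a line through
  \<open>y\<close>, so activating all these lines replaces passing through \<open>y\<close>.\<close>

lemma cluster_reveal_True:
  "cluster line (insert y U) (fun_upd \<omega> y True) P
    \<subseteq> insert y (cluster line U \<omega> (P \<union> range (\<lambda>k. (k, line k y))))"
proof
  fix x assume "x \<in> cluster line (insert y U) (fun_upd \<omega> y True) P"
  then show "x \<in> insert y (cluster line U \<omega> (P \<union> range (\<lambda>k. (k, line k y))))"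
  proof induction
    case (start x j)
    then show ?case by (auto split: if_splits intro: cluster.start)
  next
    case (step x z j)
    then show ?case
      by (auto split: if_splits intro: cluster.start[of z U \<omega> j] cluster.step[of x line U \<omega> _ z j])
  qed
qed

text \<open>Induction on the unrevealed sites. Revealing a site \<open>y\<close> of an active line of direction \<open>j\<close>
  costs that line one factor \<open>r j\<close>. If \<open>y\<close> is occupied, its own line of direction \<open>j\<close> is already
  active, so the new lines contribute at most the product of \<open>g i\<close> over \<open>i \<noteq> j\<close>.\<close>

lemma cluster_exp_moment:
  fixes line :: "'i::finite \<Rightarrow> 'v \<Rightarrow> 'l" and r g :: "'i \<Rightarrow> real"
  assumes p: "0 \<le> p" "p \<le> 1" and t: "1 \<le> t"
    and r1: "\<And>k. 1 \<le> r k"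
    and r: "\<And>k. 1 - p + p * t * (\<Prod>i\<in>UNIV - {k}. g i) \<le> r k"
    and "finite U"
    and "\<And>k b. r k ^ card {z \<in> U. line k z = b} \<le> g k"
    and "finite P"
  shows "measure_pmf.expectation (Pi_pmf U False (\<lambda>_. bernoulli_pmf p))
      (\<lambda>\<omega>. t ^ card (cluster line U \<omega> P))
    \<le> (\<Prod>(k, b)\<in>P. r k ^ card {z \<in> U. line k z = b})"
  using assms(6-8)
proof (induction "card U" arbitrary: U P)
  case 0
  then have "U = {}" by simp
  then have "cluster line U \<omega> P = {}" for \<omega>
    using cluster_subset[of line U \<omega> P] by auto
  then show ?case using \<open>U = {}\<close> by (simp add: case_prod_unfold)
next
  case (Suc n)
  define W where "W U P = (\<Prod>(k, b)\<in>P. r k ^ card {z \<in> U. line k z = b})"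
    for U and P :: "('i \<times> 'l) set"
  let ?E = "\<lambda>U. measure_pmf.expectation (Pi_pmf U False (\<lambda>_. bernoulli_pmf p))"
  have r_pow: "1 \<le> r k ^ m" for k m using r1 by simp
  show ?case
  proof (cases "\<exists>y\<in>U. \<exists>j. (j, line j y) \<in> P")
    \<comment> \<open>No active line has an unrevealed site: the exploration has stopped and the
      moment is 1.\<close>
    case False
    then have "cluster line U \<omega> P = {}" for \<omega> by (intro cluster_empty) auto
    moreover have "1 \<le> W U P" unfolding W_def
      by (intro prod_ge_1) (auto simp: r_pow)
    ultimately show ?thesis by (simp add: W_def)
  next
    case True
    then obtain y j where y: "y \<in> U" "(j, line j y) \<in> P" by blast
    define V where "V = U - {y}"
    have U: "U = insert y V" and yV: "y \<notin> V" and fV: "finite V" and cV: "n = card V"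
      using y Suc.prems(1) Suc.hyps(2) by (auto simp: V_def)
    define P' where "P' = P \<union> range (\<lambda>k. (k, line k y))"
    have fP': "finite P'" using Suc.prems by (simp add: P'_def)
    have gV: "r k ^ card {z \<in> V. line k z = b} \<le> g k" for k b
    proof -
      have "card {z \<in> V. line k z = b} \<le> card {z \<in> U. line k z = b}"
        using Suc.prems(1) by (intro card_mono) (auto simp: U)
      then have "r k ^ card {z \<in> V. line k z = b} \<le> r k ^ card {z \<in> U. line k z = b}"
        using r1 by (intro power_increasing) auto
      also have "\<dots> \<le> g k" by (rule Suc.prems)
      finally show ?thesis .
    qed
    have IH: "?E V (\<lambda>\<omega>. t ^ card (cluster line V \<omega> Q)) \<le> W V Q" if "finite Q" for Q
      unfolding W_def using Suc.hyps(1)[OF cV fV gV that] .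
    have fin_cl: "finite (cluster line V \<omega> Q)" for \<omega> Q
      using cluster_subset fV by (rule finite_subset)
    have intV: "integrable (Pi_pmf V False (\<lambda>_. bernoulli_pmf p)) h" for h :: "_ \<Rightarrow> real"
      by (intro integrable_measure_pmf_finite finite_set_Pi_pmf_bool fV)
    have "?E V (\<lambda>\<omega>. t ^ card (cluster line U (fun_upd \<omega> y False) P)) \<le> ?E V (\<lambda>\<omega>. t ^ card (cluster line V \<omega> P))"
      unfolding U using t
      by (intro integral_mono intV power_increasing card_mono fin_cl cluster_reveal_False)
    also have "\<dots> \<le> W V P" using Suc.prems(3) by (rule IH)
    finally have EF: "?E V (\<lambda>\<omega>. t ^ card (cluster line U (fun_upd \<omega> y False) P)) \<le> W V P" .
    have "card (cluster line U (fun_upd \<omega> y True) P) \<le> Suc (card (cluster line V \<omega> P'))" for \<omega>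
    proof -
      have "card (cluster line U (fun_upd \<omega> y True) P) \<le> card (insert y (cluster line V \<omega> P'))"
        unfolding U P'_def
        by (intro card_mono cluster_reveal_True finite.insertI fin_cl)
      also have "\<dots> \<le> Suc (card (cluster line V \<omega> P'))" by (rule card_insert_le_m1) auto
      finally show ?thesis .
    qed
    then have "?E V (\<lambda>\<omega>. t ^ card (cluster line U (fun_upd \<omega> y True) P))
        \<le> ?E V (\<lambda>\<omega>. t ^ Suc (card (cluster line V \<omega> P')))"
      using t by (intro integral_mono intV power_increasing)
    also have "\<dots> = t * ?E V (\<lambda>\<omega>. t ^ card (cluster line V \<omega> P'))" by simp
    also have "\<dots> \<le> t * W V P'"
      using t by (intro mult_left_mono IH fP') auto
    also have "W V P' \<le> W V P * (\<Prod>k\<in>UNIV - {j}. g k)"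
    proof -
      let ?w = "\<lambda>(k, b). r k ^ card {z \<in> V. line k z = b}"
      have w1: "1 \<le> ?w q" for q by (auto simp: r_pow split: prod.split)
      have sub: "P' - P \<subseteq> (\<lambda>k. (k, line k y)) ` (UNIV - {j})" using y by (auto simp: P'_def)
      have "P' = P \<union> (P' - P)" by (auto simp: P'_def)
      then have "W V P' = W V P * prod ?w (P' - P)"
        unfolding W_def using prod.union_disjoint[of P "P' - P" ?w] Suc.prems(3) fP' by auto
      also have "\<dots> \<le> W V P * (\<Prod>k\<in>UNIV - {j}. g k)"
      proof (rule mult_left_mono)
        \<comment> \<open>Some lines through \<open>y\<close> in other directions may be active
          already. Including them anyway only enlarges the product, as all factors are at least
          1.\<close>
        have "prod ?w (P' - P) \<le> prod ?w ((\<lambda>k. (k, line k y)) ` (UNIV - {j}))"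
        proof (rule prod_mono2)
          fix q assume "q \<in> P' - P"
          show "0 \<le> ?w q" using w1[of q] by linarith
        qed (use w1 sub in auto)
        also have "\<dots> = (\<Prod>k\<in>UNIV - {j}. r k ^ card {z \<in> V. line k z = line k y})"
          by (subst prod.reindex) (auto simp: inj_on_def)
        also have "\<dots> \<le> (\<Prod>k\<in>UNIV - {j}. g k)"
        proof (rule prod_mono)
          fix k
          show "0 \<le> r k ^ card {z \<in> V. line k z = line k y} \<and> r k ^ card {z \<in> V. line k z = line k y} \<le> g k"
            using gV order_trans[OF zero_le_one r_pow] by blast
        qed
        finally show "prod ?w (P' - P) \<le> (\<Prod>k\<in>UNIV - {j}. g k)" .
        show "0 \<le> W V P" unfolding W_def
          by (intro prod_nonneg) (auto intro: order_trans[OF zero_le_one r_pow])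
      qed
      finally show ?thesis .
    qed
    finally have ET: "?E V (\<lambda>\<omega>. t ^ card (cluster line U (fun_upd \<omega> y True) P))
        \<le> t * (W V P * (\<Prod>k\<in>UNIV - {j}. g k))"
      using t by simp
    have W0: "0 \<le> W V P" unfolding W_def
      by (intro prod_nonneg) (auto intro: order_trans[OF zero_le_one r_pow])
    have "?E U (\<lambda>\<omega>. t ^ card (cluster line U \<omega> P))
        = p * ?E V (\<lambda>\<omega>. t ^ card (cluster line U (fun_upd \<omega> y True) P))
          + (1 - p) * ?E V (\<lambda>\<omega>. t ^ card (cluster line U (fun_upd \<omega> y False) P))"
      using expectation_Pi_bernoulli_insert[OF fV yV p, of "\<lambda>\<omega>. t ^ card (cluster line U \<omega> P)"]
      by (simp only: U[symmetric])
    also have "\<dots> \<le> p * (t * (W V P * (\<Prod>k\<in>UNIV - {j}. g k))) + (1 - p) * W V P"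
      using p by (intro add_mono mult_left_mono ET EF) auto
    also have "\<dots> = W V P * (1 - p + p * t * (\<Prod>k\<in>UNIV - {j}. g k))"
      by (simp add: algebra_simps)
    also have "\<dots> \<le> W V P * r j"
      by (intro mult_left_mono r W0)
    \<comment> \<open>Restoring \<open>y\<close> gives each line through it one more site. For
      \<open>(j, line j y)\<close> the extra factor is exactly \<open>r j\<close>; for the other
      lines of \<open>P\<close> it is at least 1.\<close>
    also have "\<dots> \<le> W U P"
    proof -
      let ?q = "(j, line j y)"
      let ?v = "\<lambda>U (k, b). r k ^ card {z \<in> U. line k z = b}"
      have c: "card {z \<in> U. line k z = b} = card {z \<in> V. line k z = b} + (if line k y = b then 1 else 0)" for k b
      proof -
        have "{z \<in> U. line k z = b} = (if line k y = b then insert y {z \<in> V. line k z = b} else {z \<in> V. line k z = b})"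
          by (auto simp: U)
        then show ?thesis using fV yV by simp
      qed
      have "W V P * r j = prod (?v V) (P - {?q}) * (?v V ?q * r j)"
        unfolding W_def using Suc.prems(3) y(2) by (subst prod.remove[of P ?q]) auto
      also have "?v V ?q * r j = ?v U ?q" using c[of j "line j y"] by simp
      also have "prod (?v V) (P - {?q}) * ?v U ?q \<le> prod (?v U) (P - {?q}) * ?v U ?q"
      proof (rule mult_right_mono)
        show "prod (?v V) (P - {?q}) \<le> prod (?v U) (P - {?q})"
          by (rule prod_mono)
             (auto simp: c intro!: power_increasing r1 intro: order_trans[OF zero_le_one r_pow])
        show "0 \<le> ?v U ?q" using order_trans[OF zero_le_one r_pow] by auto
      qed
      also have "\<dots> = W U P"
        unfolding W_def using Suc.prems(3) y(2) by (subst prod.remove[of P ?q]) auto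
      finally show ?thesis .
    qed
    finally show ?thesis by (simp add: W_def)
  qed
qed

section \<open>Lines and components of the Hamming torus\<close>

text \<open>Equal values mean agreement off coordinate \<open>k\<close>. The value only labels the
  line: it is never a vertex, as vertices have coordinates at least 1.\<close>

definition torus_line :: "'d \<Rightarrow> 'a::zero ^ 'd \<Rightarrow> 'a ^ 'd" where
  "torus_line k x = (\<chi> i. if i = k then 0 else x $ i)"

lemma hamming_dist_1_torus_line:
  assumes "hamming_dist x y = 1"
  shows "\<exists>k. torus_line k y = torus_line k x"
proof -
  obtain k where "{i. x $ i \<noteq> y $ i} = {k}"
    using assms unfolding hamming_dist_def by (rule card_1_singletonE)
  then have "i \<noteq> k \<Longrightarrow> y $ i = x $ i" for i by fastforce
  then have "torus_line k y = torus_line k x"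
    by (simp add: torus_line_def vec_eq_iff)
  then show ?thesis ..
qed

text \<open>Every edge stays within a line, and \<open>v\<close> lies on its own lines. A path of
  occupied vertices from \<open>v\<close> is therefore followed by the exploration started with the
  lines through \<open>v\<close>.\<close>

lemma component_subset_cluster:
  assumes "K \<in> component_vertex_sets (with_proj (hamming_torus a n) \<restriction> {x \<in> torus_vertices a n. \<omega> x})"
    and "v \<in> K"
  shows "v \<in> torus_vertices a n"
    and "K \<subseteq> cluster torus_line (torus_vertices a n) \<omega> (range (\<lambda>k. (k, torus_line k v)))"
proof -
  let ?V = "torus_vertices a n"
  let ?G = "with_proj (hamming_torus a n) \<restriction> {x \<in> ?V. \<omega> x}"
  let ?R = "cluster torus_line ?V \<omega> (range (\<lambda>k. (k, torus_line k v)))"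
  have reach: "(v, u) \<in> rtrancl_on {x \<in> ?V. \<omega> x} (arcs_ends ?G)" if "u \<in> K" for u
    using assms that unfolding component_vertex_sets_def pre_digraph.sccs_verts_def reachable_def
    by auto
  then have v: "v \<in> ?V \<and> \<omega> v" using assms(2) in_rtrancl_on_in_F(1) by fastforce
  then show "v \<in> ?V" by simp
  have "u \<in> ?R" if "(v, u) \<in> rtrancl_on {x \<in> ?V. \<omega> x} (arcs_ends ?G)" for u
    using that
  proof (induction rule: rtrancl_on_induct)
    case base
    show ?case using v by (auto intro: cluster.start)
  next
    case (step x y)
    then have "hamming_dist x y = 1"
      by (auto simp: arcs_ends_def arc_to_ends_def hamming_torus_def)
    then obtain k where "torus_line k y = torus_line k x"
      using hamming_dist_1_torus_line by blast
    then show ?case using step by (auto intro: cluster.step)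
  qed
  then show "K \<subseteq> ?R" using reach by blast
qed

text \<open>Coordinate \<open>k\<close> determines a point of the line. With
  \<open>p = l / n\<close> the mean number of occupied sites on a line is then at most
  \<open>l * a $ k\<close>, whatever \<open>n\<close> is.\<close>

lemma card_torus_line_le:
  fixes a :: "real ^ 'd"
  assumes "a $ k > 0"
  shows "real (card {z \<in> torus_vertices a n. torus_line k z = b}) \<le> a $ k * real n"
proof -
  let ?S = "{z \<in> torus_vertices a n. torus_line k z = b}"
  have "inj_on (\<lambda>z. z $ k) ?S"
  proof (rule inj_onI)
    fix x y assume xy: "x \<in> ?S" "y \<in> ?S" "x $ k = y $ k"
    then have "torus_line k x = torus_line k y" by simp
    then have "i \<noteq> k \<Longrightarrow> x $ i = y $ i" for i
      unfolding torus_line_def vec_eq_iff vec_lambda_beta by metis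
    with xy(3) show "x = y" unfolding vec_eq_iff by metis
  qed
  moreover have "(\<lambda>z. z $ k) ` ?S \<subseteq> {1..\<lfloor>a $ k * real n\<rfloor>}"
    by (auto simp: torus_vertices_def le_floor_iff)
  ultimately have "card ?S \<le> card {1..\<lfloor>a $ k * real n\<rfloor>}"
    by (intro card_inj_on_le) auto
  then have "real (card ?S) \<le> real (nat \<lfloor>a $ k * real n\<rfloor>)" by simp
  also have "\<dots> \<le> a $ k * real n" using assms by simp
  finally show ?thesis .
qed

lemma card_torus_vertices_le:
  fixes a :: "real ^ 'd"
  assumes "\<And>i. a $ i > 0"
  shows "real (card (torus_vertices a n)) \<le> (\<Prod>i\<in>UNIV. a $ i) * real n ^ CARD('d)"
proof -
  have "inj_on vec_nth (torus_vertices a n)" by (rule inj_onI) (simp add: vec_eq_iff)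
  moreover have "vec_nth ` torus_vertices a n \<subseteq> (\<Pi>\<^sub>E i\<in>UNIV. {1..\<lfloor>a $ i * real n\<rfloor>})"
    by (auto simp: torus_vertices_def le_floor_iff)
  ultimately have "card (torus_vertices a n) \<le> card (\<Pi>\<^sub>E i\<in>(UNIV::'d set). {1..\<lfloor>a $ i * real n\<rfloor>})"
    by (intro card_inj_on_le finite_PiE) auto
  also have "\<dots> = (\<Prod>i\<in>UNIV. nat \<lfloor>a $ i * real n\<rfloor>)" by (subst card_PiE) auto
  finally have "real (card (torus_vertices a n)) \<le> (\<Prod>i\<in>UNIV. real (nat \<lfloor>a $ i * real n\<rfloor>))"
    by (metis of_nat_le_iff of_nat_prod)
  also have "\<dots> \<le> (\<Prod>i\<in>UNIV. a $ i * real n)"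
    using assms by (intro prod_mono) (simp add: less_imp_le)
  finally show ?thesis by (simp add: prod.distrib)
qed

section \<open>Choosing the weights of the lines\<close>

text \<open>To first order in \<open>e\<close>, with \<open>s k = e * v k\<close> and \<open>\<theta> = e * \<eta>\<close>, the condition reads
  \<open>l * a $ k * (\<eta> + (\<Sum>i\<noteq>k. v i)) < v k\<close>. The choice of \<open>v\<close> below has total mass 1 and solves it.\<close>

lemma subcritical_weights:
  fixes a :: "real ^ 'd"
  assumes l: "0 \<le> l" and f: "branching_sum a l < 1" and pos: "\<And>i. a $ i > 0"
  obtains \<theta> s where "\<theta> > 0" "\<And>k. 0 \<le> s k"
    "\<And>k. l * a $ k * (exp (\<theta> + (\<Sum>i\<in>UNIV - {k}. s i)) - 1) \<le> s k"
proof -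
  \<comment> \<open>The deficit of the branching sum is shared equally among the coordinates, so
    that the \<open>v k\<close> add up to 1.\<close>
  define \<eta> where "\<eta> = (1 - branching_sum a l) / CARD('d)"
  define v where "v k = l * a $ k / (1 + l * a $ k) + \<eta>" for k
  \<comment> \<open>As the \<open>v i\<close> sum to 1, \<open>b k\<close> is \<open>\<eta>\<close>
    plus the sum of \<open>v i\<close> over \<open>i \<noteq> k\<close>: the exponent per unit of
    \<open>e\<close>.\<close>
  define b where "b k = \<eta> + 1 - v k" for k
  have la: "0 \<le> l * a $ k" for k using l pos[of k] by simp
  have \<eta>: "\<eta> > 0" using f by (simp add: \<eta>_def)
  have v0: "0 \<le> v k" for k using la[of k] \<eta> by (simp add: v_def)
  have sum_v: "sum v UNIV = 1"
    by (simp add: v_def sum.distrib \<eta>_def branching_sum_def)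
  have "v k \<le> 1" for k using member_le_sum[of k UNIV v] v0 sum_v by auto
  then have b0: "0 \<le> b k" for k using \<eta> by (smt (verit) b_def)
  \<comment> \<open>The gap \<open>v k - l * a $ k * b k\<close> works out to exactly
    \<open>\<eta>\<close>.\<close>
  have strict: "l * a $ k * b k < v k" for k
  proof -
    have "(1 + l * a $ k) * (l * a $ k / (1 + l * a $ k)) = l * a $ k"
      using la[of k] by simp
    then have "(1 + l * a $ k) * v k = l * a $ k + (1 + l * a $ k) * \<eta>"
      by (simp only: v_def distrib_left)
    then show ?thesis using \<eta> by (simp add: b_def algebra_simps)
  qed
  \<comment> \<open>The quadratic term makes room for \<open>exp x - 1 \<le> x + x^2\<close> on the
    unit interval, with \<open>x = e * b k\<close>, after division by \<open>e\<close>. For small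
    \<open>e\<close> the strict gap absorbs it.\<close>
  have "\<forall>\<^sub>F e in at_right 0. l * a $ k * (b k + e * (b k)\<^sup>2) < v k \<and> e * b k < 1" for k
  proof (rule eventually_conj)
    have "((\<lambda>e. l * a $ k * (b k + e * (b k)\<^sup>2)) \<longlongrightarrow> l * a $ k * (b k + 0 * (b k)\<^sup>2)) (at_right 0)"
      by (intro tendsto_intros)
    then show "\<forall>\<^sub>F e in at_right 0. l * a $ k * (b k + e * (b k)\<^sup>2) < v k"
      by (rule order_tendstoD) (use strict in simp)
    have "((\<lambda>e. e * b k) \<longlongrightarrow> 0 * b k) (at_right 0)"
      by (intro tendsto_intros)
    then show "\<forall>\<^sub>F e in at_right 0. e * b k < 1"
      by (rule order_tendstoD) simp
  qed
  then have "\<forall>\<^sub>F e in at_right 0. \<forall>k. l * a $ k * (b k + e * (b k)\<^sup>2) < v k \<and> e * b k < 1"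
    by (rule eventually_all_finite)
  then have "\<forall>\<^sub>F e in at_right 0. 0 < e \<and> (\<forall>k. l * a $ k * (b k + e * (b k)\<^sup>2) < v k \<and> e * b k < 1)"
    by (intro eventually_conj eventually_at_right_less)
  then obtain e where e: "e > 0"
      "\<And>k. l * a $ k * (b k + e * (b k)\<^sup>2) < v k" "\<And>k. e * b k < 1"
    using eventually_happens'[OF trivial_limit_at_right_real] by blast
  show ?thesis
  proof (rule that[of "e * \<eta>" "\<lambda>k. e * v k"])
    show "0 < e * \<eta>" "\<And>k. 0 \<le> e * v k" using e(1) \<eta> v0 by simp_all
    fix k
    have "sum v (UNIV - {k}) = 1 - v k" using sum_v sum.remove[of UNIV k v] by simp
    then have "e * \<eta> + (\<Sum>i\<in>UNIV - {k}. e * v i) = e * b k"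
      unfolding sum_distrib_left[symmetric] by (simp only: b_def) (simp add: algebra_simps)
    then have "l * a $ k * (exp (e * \<eta> + (\<Sum>i\<in>UNIV - {k}. e * v i)) - 1)
        = l * a $ k * (exp (e * b k) - 1)" by simp
    also have "\<dots> \<le> l * a $ k * (e * b k + (e * b k)\<^sup>2)"
      using exp_bound[of "e * b k"] e(1) e(3)[of k] b0[of k] by (intro mult_left_mono la) simp
    also have "\<dots> = e * (l * a $ k * (b k + e * (b k)\<^sup>2))"
      by (simp add: algebra_simps power2_eq_square)
    also have "\<dots> \<le> e * v k" using e(1) e(2)[of k] by simp
    finally show "l * a $ k * (exp (e * \<eta> + (\<Sum>i\<in>UNIV - {k}. e * v i)) - 1) \<le> e * v k" .
  qed
qed

section \<open>Tail bound and union bound over starting vertices\<close>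

lemma torus_cluster_tail:
  fixes a :: "real ^ 'd"
  assumes pos: "\<And>i. a $ i > 0" and l: "0 \<le> l" "l \<le> real n" and n: "0 < n"
    and \<theta>: "0 < \<theta>" and s0: "\<And>k. 0 \<le> s k"
    and s: "\<And>k. l * a $ k * (exp (\<theta> + (\<Sum>i\<in>UNIV - {k}. s i)) - 1) \<le> s k"
  shows "measure_pmf.prob (Pi_pmf (torus_vertices a n) False (\<lambda>_. bernoulli_pmf (l / real n)))
      {\<omega>. m \<le> real (card (cluster torus_line (torus_vertices a n) \<omega> (range (\<lambda>k. (k, torus_line k v)))))}
    \<le> exp (\<Sum>k\<in>UNIV. s k) / exp (\<theta> * m)"
proof -
  let ?V = "torus_vertices a n"
  let ?p = "l / real n"
  let ?Q = "Pi_pmf ?V False (\<lambda>_. bernoulli_pmf ?p)"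
  let ?c = "\<lambda>\<omega>. card (cluster torus_line ?V \<omega> (range (\<lambda>k. (k, torus_line k v))))"
  define x where "x k = exp (\<theta> + (\<Sum>i\<in>UNIV - {k}. s i)) - 1" for k
  \<comment> \<open>The one-site condition of \<open>cluster_exp_moment\<close> then holds with
    equality for \<open>t = exp \<theta>\<close> and \<open>g k = exp (s k)\<close>.\<close>
  define r where "r k = 1 + ?p * x k" for k
  have p: "0 \<le> ?p" "?p \<le> 1" using l n by simp_all
  have x0: "0 \<le> x k" for k using \<theta> s0 by (simp add: x_def sum_nonneg)
  have px0: "0 \<le> ?p * x k" for k using p(1) x0 by (rule mult_nonneg_nonneg)
  then have r1: "1 \<le> r k" for k by (simp add: r_def)
  have rg: "r k ^ card {z \<in> ?V. torus_line k z = b} \<le> exp (s k)" for k and b :: "int ^ 'd"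
  proof -
    let ?m = "card {z \<in> ?V. torus_line k z = b}"
    \<comment> \<open>By \<open>1 + y \<le> exp y\<close>, a line of at most
      \<open>a $ k * n\<close> sites has weight at most \<open>exp (l * a $ k * x k)\<close>: the
      factor \<open>n\<close> cancels against \<open>p = l / n\<close>.\<close>
    have "r k ^ ?m \<le> exp (?p * x k) ^ ?m"
      using r1[of k] exp_ge_add_one_self[of "?p * x k"] by (intro power_mono) (simp_all add: r_def)
    also have "\<dots> = exp (real ?m * (?p * x k))" by (simp only: exp_of_nat_mult)
    also have "real ?m * (?p * x k) \<le> (a $ k * real n) * (?p * x k)"
      by (intro mult_right_mono card_torus_line_le pos px0)
    also have "\<dots> = l * a $ k * x k" using n by simp
    also have "\<dots> \<le> s k" using s by (simp add: x_def)
    finally show ?thesis by simp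
  qed
  have "measure_pmf.expectation ?Q (\<lambda>\<omega>. exp \<theta> ^ ?c \<omega>)
      \<le> (\<Prod>(k, b)\<in>range (\<lambda>k. (k, torus_line k v)). r k ^ card {z \<in> ?V. torus_line k z = b})"
  proof (rule cluster_exp_moment[where g = "\<lambda>k. exp (s k)"])
    fix k
    show "1 - ?p + ?p * exp \<theta> * (\<Prod>i\<in>UNIV - {k}. exp (s i)) \<le> r k"
      unfolding r_def x_def exp_add exp_sum[OF finite] by (simp only: right_diff_distrib mult.assoc)
  qed (fact p r1 rg finite_torus_vertices | use \<theta> in simp)+
  also have "\<dots> = (\<Prod>k\<in>UNIV. r k ^ card {z \<in> ?V. torus_line k z = torus_line k v})"
    by (subst prod.reindex) (auto simp: inj_on_def)
  also have "\<dots> \<le> (\<Prod>k\<in>UNIV. exp (s k))"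
    using rg order_trans[OF zero_le_one r1] by (intro prod_mono) simp
  also have "\<dots> = exp (\<Sum>k\<in>UNIV. s k)" by (simp add: exp_sum)
  also have "(\<lambda>\<omega>. exp \<theta> ^ ?c \<omega>) = (\<lambda>\<omega>. exp (\<theta> * ?c \<omega>))"
    by (simp only: exp_of_nat2_mult)
  finally have E: "measure_pmf.expectation ?Q (\<lambda>\<omega>. exp (\<theta> * ?c \<omega>)) \<le> exp (\<Sum>k\<in>UNIV. s k)" .
  have "{\<omega>. m \<le> real (?c \<omega>)} = {\<omega> \<in> space ?Q. exp (\<theta> * m) \<le> exp (\<theta> * ?c \<omega>)}"
    using \<theta> by simp
  also have "measure_pmf.prob ?Q \<dots> \<le> measure_pmf.expectation ?Q (\<lambda>\<omega>. exp (\<theta> * ?c \<omega>)) / exp (\<theta> * m)"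
    by (rule integral_Markov_inequality_measure[where A = UNIV])
       (auto intro: integrable_measure_pmf_finite finite_set_Pi_pmf_bool finite_torus_vertices)
  also have "\<dots> \<le> exp (\<Sum>k\<in>UNIV. s k) / exp (\<theta> * m)"
    by (intro divide_right_mono E) simp
  finally show ?thesis .
qed

lemma subcritical_components_log:
  fixes a :: "real ^ 'd"
  assumes pos: "\<And>i. a $ i > 0" and l: "0 \<le> l" and f: "branching_sum a l < 1"
  shows "\<exists>C::real.
    (\<lambda>n. measure_pmf.prob (random_site_subgraph a n (l / real n))
       {G. \<forall>K \<in> component_vertex_sets G. real (card K) \<le> C * ln (real n)})
    \<longlonglongrightarrow> 1"
proof -
  obtain \<theta> s where \<theta>: "\<theta> > 0" and s0: "\<And>k. 0 \<le> s k"
    and s: "\<And>k. l * a $ k * (exp (\<theta> + (\<Sum>i\<in>UNIV - {k}. s i)) - 1) \<le> s k"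
    using subcritical_weights[OF l f pos] by blast
  \<comment> \<open>Makes \<open>exp (\<theta> * C * ln n)\<close> equal to
    \<open>n ^ (d + 1)\<close>, one power of \<open>n\<close> above the order of the number of
    vertices.\<close>
  define C where "C = (CARD('d) + 1) / \<theta>"
  define A where "A = (\<Prod>i\<in>UNIV. a $ i) * exp (\<Sum>k\<in>UNIV. s k)"
  let ?P = "\<lambda>n. measure_pmf.prob (random_site_subgraph a n (l / real n))
       {G. \<forall>K \<in> component_vertex_sets G. real (card K) \<le> C * ln (real n)}"
  have lower: "1 - A / real n \<le> ?P n" if n: "0 < n" "l \<le> real n" for n
  proof -
    let ?V = "torus_vertices a n"
    let ?Q = "Pi_pmf ?V False (\<lambda>_. bernoulli_pmf (l / real n))"
    let ?m = "C * ln (real n)"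
    let ?c = "\<lambda>v \<omega>. cluster torus_line ?V \<omega> (range (\<lambda>k. (k, torus_line k v)))"
    let ?B = "\<lambda>v. {\<omega>. ?m \<le> real (card (?c v \<omega>))}"
    define T where "T = (\<lambda>\<omega>. with_proj (hamming_torus a n) \<restriction> {x \<in> ?V. \<omega> x}) -`
      {G. \<forall>K \<in> component_vertex_sets G. real (card K) \<le> ?m}"
    \<comment> \<open>Components are nonempty, and every vertex of one with more than
      \<open>?m\<close> vertices has a cluster at least as large.\<close>
    have "- T \<subseteq> (\<Union>v\<in>?V. ?B v)"
    proof
      fix \<omega> assume "\<omega> \<in> - T"
      then obtain K where K: "?m < real (card K)"
        "K \<in> component_vertex_sets (with_proj (hamming_torus a n) \<restriction> {x \<in> ?V. \<omega> x})"
        by (auto simp: T_def not_le)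
      then obtain v where "v \<in> K"
        by (auto simp: component_vertex_sets_def pre_digraph.sccs_verts_def)
      note v = component_subset_cluster[OF K(2) this]
      have "card K \<le> card (?c v \<omega>)"
        using finite_subset[OF cluster_subset finite_torus_vertices] v(2) by (rule card_mono)
      with K(1) v(1) show "\<omega> \<in> (\<Union>v\<in>?V. ?B v)" by fastforce
    qed
    then have "measure_pmf.prob ?Q (- T) \<le> measure_pmf.prob ?Q (\<Union>v\<in>?V. ?B v)"
      by (intro measure_pmf.finite_measure_mono) auto
    also have "\<dots> \<le> (\<Sum>v\<in>?V. measure_pmf.prob ?Q (?B v))"
      by (intro measure_pmf.finite_measure_subadditive_finite finite_torus_vertices) auto
    also have "\<dots> \<le> (\<Sum>v\<in>?V. exp (\<Sum>k\<in>UNIV. s k) / exp (\<theta> * ?m))"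
      by (intro sum_mono torus_cluster_tail pos l n \<theta> s0 s)
    also have "\<dots> = real (card ?V) * exp (\<Sum>k\<in>UNIV. s k) / exp (\<theta> * ?m)" by simp
    also have "exp (\<theta> * ?m) = real n ^ (CARD('d) + 1)"
    proof -
      have "\<theta> * ?m = real (CARD('d) + 1) * ln (real n)" using \<theta> by (simp add: C_def)
      then show ?thesis using n(1) by (simp only: exp_of_nat_mult) simp
    qed
    also have "real (card ?V) * exp (\<Sum>k\<in>UNIV. s k) / real n ^ (CARD('d) + 1)
        \<le> ((\<Prod>i\<in>UNIV. a $ i) * real n ^ CARD('d)) * exp (\<Sum>k\<in>UNIV. s k) / real n ^ (CARD('d) + 1)"
      by (intro divide_right_mono mult_right_mono card_torus_vertices_le pos) simp_all
    also have "\<dots> = A / real n" using n(1) by (simp add: A_def)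
    finally have "measure_pmf.prob ?Q (- T) \<le> A / real n" .
    moreover have "measure_pmf.prob ?Q (- T) = 1 - measure_pmf.prob ?Q T"
      using measure_pmf.prob_compl[of T ?Q] by (simp add: Compl_eq_Diff_UNIV)
    moreover have "?P n = measure_pmf.prob ?Q T"
      by (simp add: random_site_subgraph_def T_def)
    ultimately show ?thesis by linarith
  qed
  have "?P \<longlonglongrightarrow> 1"
  proof (rule tendsto_sandwich)
    have "(\<lambda>n. 1 - A * (1 / real n)) \<longlonglongrightarrow> 1 - A * 0"
      by (intro tendsto_intros lim_1_over_n)
    then show "(\<lambda>n. 1 - A / real n) \<longlonglongrightarrow> 1" by simp
    \<comment> \<open>From \<open>Suc N\<close> on, \<open>n\<close> is positive and at least
      \<open>l\<close>, so that \<open>l / n\<close> is a genuine probability.\<close>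
    obtain N where "l \<le> real N" using real_arch_simple by blast
    then show "\<forall>\<^sub>F n in sequentially. 1 - A / real n \<le> ?P n"
      by (intro eventually_sequentiallyI[of "Suc N"] lower) auto
  qed auto
  then show ?thesis ..
qed

theorem theorem1p1:
  fixes a :: "real ^ 'd"
  assumes "CARD('d) \<ge> 2"
    and "\<And>i. a $ i > 0"
  shows "(\<exists>!l. l > 0 \<and> det (M_matrix a l - mat 1) = 0) \<and>
    (\<forall>l. 0 \<le> l \<and> l < lambda_c a \<longrightarrow>
      (\<exists>C::real.
        (\<lambda>n. measure_pmf.prob (random_site_subgraph a n (l / real n))
           {G. \<forall>K \<in> component_vertex_sets G. real (card K) \<le> C * ln (real n)})
        \<longlonglongrightarrow> 1))"
proof (intro conjI allI impI)
  have iff: "l > 0 \<and> det (M_matrix a l - mat 1) = 0 \<longleftrightarrow> l > 0 \<and> branching_sum a l = 1" for l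
    using det_M_matrix_eq_0_iff[of l a] assms(2) by auto
  show ex1: "\<exists>!l. l > 0 \<and> det (M_matrix a l - mat 1) = 0"
    unfolding iff using assms by (rule ex1_branching_sum_eq_1)
  \<comment> \<open>Unique existence makes the definite description \<open>lambda_c a\<close> denote
    the root.\<close>
  have crit: "branching_sum a (lambda_c a) = 1"
    using theI'[OF ex1] iff unfolding lambda_c_def by blast
  fix l assume l: "0 \<le> l \<and> l < lambda_c a"
  then have "branching_sum a l < 1"
    using branching_sum_strict_mono[of l "lambda_c a" a] assms(2) crit by simp
  then show "\<exists>C::real.
      (\<lambda>n. measure_pmf.prob (random_site_subgraph a n (l / real n))
         {G. \<forall>K \<in> component_vertex_sets G. real (card K) \<le> C * ln (real n)})
      \<longlonglongrightarrow> 1"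
    using subcritical_components_log[of a l] assms(2) l by blast
qed

end
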